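(* Let $\Omega\subset\mathbb{H}$ be a bounded h-convex domain and let $f\in C(\overline{\Omega})$ satisfy, for some $K\in\mathbb{R}$, $f=K$ on $\partial\Omega$ and $f\le K$ in $\overline{\Omega}$. Let $Q(f)\in USC(\Omega)$ be the h-quasiconvex envelope of $f$ in $\Omega$. Let $u_0=f$ and, for $n=1,2,\ldots$, let $u_n\in C(\overline{\Omega})$ be the unique viscosity solution of the nonlocal Hamilton-Jacobi equation $$u_n(p)+H(p,u_n(p),\nabla_H u_n(p))=u_{n-1}(p)\quad\text{in }\Omega$$ satisfying $u_n=K$ on $\partial\Omega$ and $u_n\le K$ in $\overline{\Omega}$. Then $u_n\to Q(f)$ uniformly in $\overline{\Omega}$ as $n\to\infty$.
   Context: The Heisenberg group $\mathbb{H}$ is $\mathbb{R}^3$ (with its usual topology) with the group law $(x_p,y_p,z_p)\cdot(x_q,y_q,z_q)=(x_p+x_q,\,y_p+y_q,\,z_p+z_q+\frac12(x_py_q-x_qy_p))$. Let $\mathbb{H}_0=\{(x,y,0):x,y\in\mathbb{R}\}$ and, for $p\in\mathbb{H}$, $\mathbb{H}_p=\{p\cdot h:h\in\mathbb{H}_0\}$ (horizontal plane through $p$). For $q\in\mathbb{H}_p$, $[p,q]$ denotes the horizontal segment joining $p$ and $q$ (the straight segment from $p$ to $q$). For $\zeta=(x,y,z)\in\mathbb{H}$ write $\zeta_h=(x,y)$. With $X_1=\partial_x-\frac y2\partial_z$ and $X_2=\partial_y+\frac x2\partial_z$, the horizontal gradient is $\nabla_H\varphi=(X_1\varphi,X_2\varphi)$.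 A domain is a connected open set. A set $E\subset\mathbb{H}$ is h-convex if $[p,q]\subset E$ for every $p\in E$ and $q\in\mathbb{H}_p\cap E$. For $\Omega$ h-convex, $u:\Omega\to\mathbb{R}$ is h-quasiconvex if $u(w)\le\max\{u(p),u(q)\}$ for all $p\in\Omega$, $q\in\mathbb{H}_p\cap\Omega$, $w\in[p,q]$. The h-quasiconvex envelope of $f$ in $\Omega$ is $Q(f)(p)=\sup\{g(p): g\le f \text{ in }\Omega,\ g:\Omega\to\mathbb{R}\text{ h-quasiconvex}\}$; under the boundary conditions on $f$ considered here, $Q(f)$ is understood on $\partial\Omega$ as taking the value $Q(f)=f=K$. $USC$ denotes upper semicontinuous functions and $LSC$ lower semicontinuous functions. For $u:\Omega\to\mathbb{R}$ and $p\in\Omega$ put $S_p(u)=\{\xi\in\mathbb{H}_p\cap\Omega:u(\xi)<u(p)\}$ and $\hat S_p(u)=\{\xi\in\mathbb{H}_p\cap\Omega:u(\xi)\le u(p)\}$. The equation $u+H(p,u,\nabla_Hu)=f$ in $\Omega$ is understood as follows. Subsolution ($f\in USC(\Omega)$ locally bounded): a locally bounded $u\in USC(\Omega)$ such that whenever $p\in\Omega$ and $\varphi\in C^1(\Omega)$ are such that $u-\varphi$ attains a maximum at $p$, one has $u(p)+\sup\{\langle\nabla_H\varphi(p),(p^{-1}\cdot\xi)_h\rangle:\xi\in S_p(u)\}\le f(p)$, the supremum being taken as $0$ if $\nabla_H\varphi(p)=0$. Supersolution ($f\in LSC(\Omega)$ locally bounded): a locally bounded $u\in LSC(\Omega)$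 such that whenever $p\in\Omega$ and $\varphi\in C^1(\Omega)$ are such that $u-\varphi$ attains a minimum at $p$, one has $u(p)+\sup\{\langle\nabla_H\varphi(p),(p^{-1}\cdot\xi)_h\rangle:\xi\in\hat S_p(u)\}\ge f(p)$. A (viscosity) solution is a continuous function that is both a subsolution and a supersolution. *)

theory Defs
  imports "HOL-Analysis.Analysis"
begin

section \<open>The Heisenberg group\<close>

type_synonym heis = "real \<times> real \<times> real"

fun heis_mult :: "heis \<Rightarrow> heis \<Rightarrow> heis"  (infixl "\<odot>" 70) where
  "(x1, y1, z1) \<odot> (x2, y2, z2) =
     (x1 + x2, y1 + y2, z1 + z2 + (x1 * y2 - x2 * y1) / 2)"

fun heis_inv :: "heis \<Rightarrow> heis" where
  "heis_inv (x, y, z) = (- x, - y, - z)"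

lemma heis_mult_assoc: "(p \<odot> q) \<odot> r = p \<odot> (q \<odot> r)"
  by (cases p; cases q; cases r) (simp add: field_simps)

lemma heis_mult_zero [simp]: "p \<odot> 0 = p" "0 \<odot> p = p"
  by (cases p; simp add: zero_prod_def)+

lemma heis_inv_mult [simp]: "heis_inv p \<odot> p = 0" "p \<odot> heis_inv p = 0"
  by (cases p; simp add: zero_prod_def)+

fun hpart :: "heis \<Rightarrow> real \<times> real" where
  "hpart (x, y, z) = (x, y)"

definition horiz_plane0 :: "heis set" where
  "horiz_plane0 = {(x, y, 0) | x y. True}"

definition horiz_plane :: "heis \<Rightarrow> heis set" where
  "horiz_plane p = {p \<odot> h | h. h \<in> horiz_plane0}"

section \<open>h-convexity and the h-quasiconvex envelope\<close>

definition h_convex :: "heis set \<Rightarrow> bool" where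
  "h_convex E \<longleftrightarrow> (\<forall>p\<in>E. \<forall>q\<in>horiz_plane p \<inter> E. closed_segment p q \<subseteq> E)"

definition h_quasiconvex_on :: "heis set \<Rightarrow> (heis \<Rightarrow> real) \<Rightarrow> bool" where
  "h_quasiconvex_on \<Omega> u \<longleftrightarrow>
     (\<forall>p\<in>\<Omega>. \<forall>q\<in>horiz_plane p \<inter> \<Omega>. \<forall>w\<in>closed_segment p q. u w \<le> max (u p) (u q))"

text \<open>The supremum is meant for \<open>p \<in> \<Omega>\<close> and \<open>f\<close> bounded below on \<open>\<Omega>\<close>; the set is then
  nonempty (constants are h-quasiconvex) and bounded above by \<open>f p\<close>.\<close>

definition h_envelope :: "heis set \<Rightarrow> (heis \<Rightarrow> real) \<Rightarrow> heis \<Rightarrow> real" where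
  "h_envelope \<Omega> f p = Sup {g p | g. (\<forall>q\<in>\<Omega>. g q \<le> f q) \<and> h_quasiconvex_on \<Omega> g}"

text \<open>The envelope extended to \<open>closure \<Omega>\<close> by the boundary values of \<open>f\<close>.\<close>

definition h_envelope_closure :: "heis set \<Rightarrow> (heis \<Rightarrow> real) \<Rightarrow> heis \<Rightarrow> real" where
  "h_envelope_closure \<Omega> f p = (if p \<in> \<Omega> then h_envelope \<Omega> f p else f p)"

section \<open>Function classes\<close>

definition usc_on :: "'a::topological_space set \<Rightarrow> ('a \<Rightarrow> real) \<Rightarrow> bool" where
  "usc_on S u \<longleftrightarrow> (\<forall>p\<in>S. \<forall>a>u p. \<forall>\<^sub>F q in at p within S. u q < a)"

definition lsc_on :: "'a::topological_space set \<Rightarrow> ('a \<Rightarrow> real) \<Rightarrow> bool" where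
  "lsc_on S u \<longleftrightarrow> (\<forall>p\<in>S. \<forall>a<u p. \<forall>\<^sub>F q in at p within S. a < u q)"

definition locally_bounded_on :: "'a::topological_space set \<Rightarrow> ('a \<Rightarrow> real) \<Rightarrow> bool" where
  "locally_bounded_on S u \<longleftrightarrow> (\<forall>p\<in>S. \<exists>U. open U \<and> p \<in> U \<and> bounded (u ` (U \<inter> S)))"

definition C1_on :: "'a::real_normed_vector set \<Rightarrow> ('a \<Rightarrow> real) \<Rightarrow> bool" where
  "C1_on S \<phi> \<longleftrightarrow> (\<exists>\<phi>' :: 'a \<Rightarrow> 'a \<Rightarrow>\<^sub>L real.
     (\<forall>p\<in>S. (\<phi> has_derivative blinfun_apply (\<phi>' p)) (at p)) \<and> continuous_on S \<phi>')"

text \<open>\<open>frechet_derivative \<phi> (at p)\<close> applied to the coordinate vectors gives the partial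
  derivatives, so the components below are
  \<open>X\<^sub>1 \<phi> = \<partial>\<^sub>x \<phi> - y/2 \<partial>\<^sub>z \<phi>\<close> and \<open>X\<^sub>2 \<phi> = \<partial>\<^sub>y \<phi> + x/2 \<partial>\<^sub>z \<phi>\<close>.\<close>

definition hgrad :: "(heis \<Rightarrow> real) \<Rightarrow> heis \<Rightarrow> real \<times> real" where
  "hgrad \<phi> p = (case p of (x, y, z) \<Rightarrow>
     (let D = frechet_derivative \<phi> (at p)
      in (D (1, 0, 0) - y / 2 * D (0, 0, 1), D (0, 1, 0) + x / 2 * D (0, 0, 1))))"

section \<open>The nonlocal Hamilton-Jacobi equation\<close>

definition strict_sublevel :: "heis set \<Rightarrow> (heis \<Rightarrow> real) \<Rightarrow> heis \<Rightarrow> heis set" where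
  "strict_sublevel \<Omega> u p = {\<xi> \<in> horiz_plane p \<inter> \<Omega>. u \<xi> < u p}"

definition weak_sublevel :: "heis set \<Rightarrow> (heis \<Rightarrow> real) \<Rightarrow> heis \<Rightarrow> heis set" where
  "weak_sublevel \<Omega> u p = {\<xi> \<in> horiz_plane p \<inter> \<Omega>. u \<xi> \<le> u p}"

text \<open>The supremum is taken in \<^typ>\<open>ereal\<close>, so that it is \<open>-\<infinity>\<close> over the empty
  set and \<open>\<infinity>\<close> when unbounded, instead of being unspecified.\<close>

definition hsup :: "heis set \<Rightarrow> heis \<Rightarrow> real \<times> real \<Rightarrow> ereal" where
  "hsup S p v = (SUP \<xi>\<in>S. ereal (v \<bullet> hpart (heis_inv p \<odot> \<xi>)))"

definition hj_subsolution :: "heis set \<Rightarrow> (heis \<Rightarrow> real) \<Rightarrow> (heis \<Rightarrow> real) \<Rightarrow> bool" where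
  "hj_subsolution \<Omega> f u \<longleftrightarrow>
     usc_on \<Omega> f \<and> locally_bounded_on \<Omega> f \<and> usc_on \<Omega> u \<and> locally_bounded_on \<Omega> u \<and>
     (\<forall>p\<in>\<Omega>. \<forall>\<phi>. C1_on \<Omega> \<phi> \<and> (\<forall>q\<in>\<Omega>. u q - \<phi> q \<le> u p - \<phi> p) \<longrightarrow>
        ereal (u p) + (if hgrad \<phi> p = 0 then 0 else hsup (strict_sublevel \<Omega> u p) p (hgrad \<phi> p))
          \<le> ereal (f p))"

definition hj_supersolution :: "heis set \<Rightarrow> (heis \<Rightarrow> real) \<Rightarrow> (heis \<Rightarrow> real) \<Rightarrow> bool" where
  "hj_supersolution \<Omega> f u \<longleftrightarrow>
     lsc_on \<Omega> f \<and> locally_bounded_on \<Omega> f \<and> lsc_on \<Omega> u \<and> locally_bounded_on \<Omega> u \<and>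
     (\<forall>p\<in>\<Omega>. \<forall>\<phi>. C1_on \<Omega> \<phi> \<and> (\<forall>q\<in>\<Omega>. u q - \<phi> q \<ge> u p - \<phi> p) \<longrightarrow>
        ereal (u p) + hsup (weak_sublevel \<Omega> u p) p (hgrad \<phi> p) \<ge> ereal (f p))"

definition hj_viscosity_solution :: "heis set \<Rightarrow> (heis \<Rightarrow> real) \<Rightarrow> (heis \<Rightarrow> real) \<Rightarrow> bool" where
  "hj_viscosity_solution \<Omega> f u \<longleftrightarrow>
     continuous_on \<Omega> u \<and> hj_subsolution \<Omega> f u \<and> hj_supersolution \<Omega> f u"

end

theory Submission
  imports Defs
begin

text \<open>
  Left translations map horizontal lines to horizontal lines, so they preserve h-quasiconvexity.
  Applied to the envelope extended by \<open>K\<close> outside \<open>\<Omega>\<close>, this carries the uniform continuity of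
  \<open>f\<close> over to \<open>Q(f)\<close>.  The comparison \<open>Q(f) \<le> u\<^sub>n\<close> doubles variables with the penalty
  \<open>C |p q\<^sup>-\<^sup>1|\<^sup>2\<close>, again because translates of \<open>Q(f)\<close> are h-quasiconvex.  Subsolutions lie below
  the right-hand side, so \<open>u\<^sub>n\<close> decreases to some \<open>U\<close> with \<open>Q(f) \<le> U \<le> f\<close>.  If \<open>U\<close> were not
  h-quasiconvex on a horizontal segment, then for a suitable test function \<open>\<phi>\<close> concentrated on that
  segment the maximum of \<open>u\<^sub>n - \<phi>\<close> would drop by a fixed positive amount at every step, which is
  impossible since \<open>u\<^sub>n\<close> is bounded below.  Hence \<open>U = Q(f)\<close>, and Dini's theorem applies.
\<close>

section \<open>Horizontal lines\<close>

definition hvec :: "real \<times> real \<Rightarrow> heis" where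
  "hvec v = (fst v, snd v, 0)"

lemma hvec_0 [simp]: "hvec 0 = 0"
  by (simp add: hvec_def zero_prod_def)

lemma hvec_scaleR_mult: "hvec (s *\<^sub>R v) \<odot> hvec (t *\<^sub>R v) = hvec ((s + t) *\<^sub>R v)"
  by (simp add: hvec_def algebra_simps)

lemma horiz_plane_iff: "q \<in> horiz_plane p \<longleftrightarrow> (\<exists>v. q = p \<odot> hvec v)"
  by (force simp: horiz_plane_def horiz_plane0_def hvec_def)

lemma mult_hvec_in_horiz_plane [simp]: "p \<odot> hvec v \<in> horiz_plane p"
  unfolding horiz_plane_iff by (rule exI, rule refl)

lemma hpart_inv_mult_hvec [simp]: "hpart (heis_inv p \<odot> (p \<odot> hvec v)) = v"
  by (simp add: heis_mult_assoc[symmetric]) (simp add: hvec_def)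

text \<open>The twisting term of the group law is linear in its second factor, so the curve is
  affine in \<open>t\<close>. Straight segments from \<open>p\<close> inside its horizontal plane
  are therefore orbits of one-parameter subgroups, which left translations respect.\<close>

lemma mult_hvec_scaleR: "p \<odot> hvec (t *\<^sub>R v) = (1 - t) *\<^sub>R p + t *\<^sub>R (p \<odot> hvec v)"
  by (cases p) (simp add: hvec_def algebra_simps diff_divide_distrib)

lemma mem_closed_segment_hvec:
  "w \<in> closed_segment p (p \<odot> hvec v) \<longleftrightarrow> (\<exists>t. 0 \<le> t \<and> t \<le> 1 \<and> w = p \<odot> hvec (t *\<^sub>R v))"
  by (auto simp: in_segment mult_hvec_scaleR)

lemma h_convex_mult_hvec:
  assumes "h_convex E" "p \<in> E" "p \<odot> hvec v \<in> E" "0 \<le> t" "t \<le> 1"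
  shows "p \<odot> hvec (t *\<^sub>R v) \<in> E"
proof -
  have "p \<odot> hvec v \<in> horiz_plane p \<inter> E"
    using assms(3) by simp
  then have "closed_segment p (p \<odot> hvec v) \<subseteq> E"
    using assms(1,2) unfolding h_convex_def by blast
  moreover have "p \<odot> hvec (t *\<^sub>R v) \<in> closed_segment p (p \<odot> hvec v)"
    using assms(4,5) unfolding mem_closed_segment_hvec by blast
  ultimately show ?thesis by blast
qed

text \<open>With segments written through the group law, passing from a function on the whole space
  to its left translates needs only associativity.\<close>

lemma h_quasiconvex_on_iff:
  "h_quasiconvex_on \<Omega> g \<longleftrightarrow>
     (\<forall>p v t. p \<in> \<Omega> \<longrightarrow> p \<odot> hvec v \<in> \<Omega> \<longrightarrow> 0 \<le> t \<longrightarrow> t \<le> 1 \<longrightarrow>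
       g (p \<odot> hvec (t *\<^sub>R v)) \<le> max (g p) (g (p \<odot> hvec v)))"
proof -
  have "(\<forall>q\<in>horiz_plane p \<inter> \<Omega>. \<forall>w\<in>closed_segment p q. g w \<le> max (g p) (g q)) \<longleftrightarrow>
      (\<forall>v. p \<odot> hvec v \<in> \<Omega> \<longrightarrow> (\<forall>w\<in>closed_segment p (p \<odot> hvec v). g w \<le> max (g p) (g (p \<odot> hvec v))))" for p
    unfolding Ball_def Int_iff horiz_plane_iff by metis
  moreover have "(\<forall>w\<in>closed_segment p (p \<odot> hvec v). g w \<le> b) \<longleftrightarrow>
      (\<forall>t. 0 \<le> t \<longrightarrow> t \<le> 1 \<longrightarrow> g (p \<odot> hvec (t *\<^sub>R v)) \<le> b)" for p v b
    unfolding Ball_def mem_closed_segment_hvec by metis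
  ultimately show ?thesis unfolding h_quasiconvex_on_def by blast
qed

lemma continuous_on_heis_mult [continuous_intros]:
  assumes "continuous_on S f" "continuous_on S g"
  shows "continuous_on S (\<lambda>x. f x \<odot> g x)"
proof -
  have "f x \<odot> g x = (fst (f x) + fst (g x), fst (snd (f x)) + fst (snd (g x)),
      snd (snd (f x)) + snd (snd (g x)) + (fst (f x) * fst (snd (g x)) - fst (g x) * fst (snd (f x))) / 2)" for x
    by (cases "f x"; cases "g x") simp
  then show ?thesis using assms by (auto intro!: continuous_intros)
qed

lemma heis_inv_eq: "heis_inv p = - p"
  by (cases p) simp

lemma continuous_on_heis_inv [continuous_intros]:
  "continuous_on S f \<Longrightarrow> continuous_on S (\<lambda>x. heis_inv (f x))"
  by (simp add: heis_inv_eq continuous_on_minus)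

lemma continuous_on_hvec [continuous_intros]:
  "continuous_on S f \<Longrightarrow> continuous_on S (\<lambda>x. hvec (f x))"
  unfolding hvec_def by (intro continuous_intros)

lemma hpart_eq: "hpart p = (fst p, fst (snd p))"
  by (cases p) simp

lemma continuous_on_hpart [continuous_intros]:
  "continuous_on S f \<Longrightarrow> continuous_on S (\<lambda>x. hpart (f x))"
  unfolding hpart_eq by (intro continuous_intros)

section \<open>Test functions\<close>

lemma C1_on_const: "C1_on S (\<lambda>x. c)"
  unfolding C1_on_def by (rule exI[of _ "\<lambda>_. 0"]) (auto simp: zero_blinfun.rep_eq)

lemma C1_on_bounded_linear:
  assumes "bounded_linear f" shows "C1_on S f"
  unfolding C1_on_def
  by (rule exI[of _ "\<lambda>_. Blinfun f"])
    (auto simp: bounded_linear_Blinfun_apply[OF assms] bounded_linear_imp_has_derivative[OF assms])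

lemma C1_on_add:
  assumes "C1_on S f" "C1_on S g" shows "C1_on S (\<lambda>x. f x + g x)"
proof -
  obtain f' g' where "\<forall>p\<in>S. (f has_derivative blinfun_apply (f' p)) (at p)" "continuous_on S f'"
    "\<forall>p\<in>S. (g has_derivative blinfun_apply (g' p)) (at p)" "continuous_on S g'"
    using assms unfolding C1_on_def by blast
  then show ?thesis unfolding C1_on_def
    by (intro exI[of _ "\<lambda>x. f' x + g' x"])
      (auto simp: plus_blinfun.rep_eq intro!: continuous_intros has_derivative_add)
qed

lemma C1_on_compose:
  assumes "C1_on S f" "\<And>x. (g has_real_derivative g' x) (at x)" "continuous_on UNIV g'"
  shows "C1_on S (\<lambda>x. g (f x))"
proof -
  obtain f' where f': "\<forall>p\<in>S. (f has_derivative blinfun_apply (f' p)) (at p)" "continuous_on S f'"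
    using assms unfolding C1_on_def by blast
  then have "continuous_on S f"
    by (meson continuous_at_imp_continuous_on has_derivative_continuous)
  then have "continuous_on S (\<lambda>x. g' (f x))"
    using continuous_on_compose2[OF assms(3)] by auto
  moreover have "((\<lambda>x. g (f x)) has_derivative blinfun_apply (g' (f p) *\<^sub>R f' p)) (at p)" if "p \<in> S" for p
    using has_derivative_compose[of f "blinfun_apply (f' p)" p UNIV g "(*) (g' (f p))"] f' that assms(2)[of "f p"]
    by (simp add: scaleR_blinfun.rep_eq has_field_derivative_def)
  ultimately show ?thesis unfolding C1_on_def using f'
    by (intro exI[of _ "\<lambda>x. g' (f x) *\<^sub>R f' x"]) (auto intro!: continuous_intros)
qed

lemma C1_on_cmult:
  assumes "C1_on S f" shows "C1_on S (\<lambda>x. c * f x)"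
  using C1_on_compose[OF assms, of "\<lambda>x. c * x" "\<lambda>_. c"] by (auto intro!: derivative_eq_intros)

lemma C1_on_power2:
  assumes "C1_on S f" shows "C1_on S (\<lambda>x. (f x)\<^sup>2)"
  by (rule C1_on_compose[OF assms, of "\<lambda>x. x\<^sup>2" "\<lambda>x. 2 * x"])
    (auto intro!: derivative_eq_intros continuous_intros)

lemma C1_on_diff:
  assumes "C1_on S f" "C1_on S g" shows "C1_on S (\<lambda>x. f x - g x)"
  using C1_on_add[OF assms(1) C1_on_cmult[OF assms(2), of "-1"]] by simp

text \<open>Polarization: a product is a combination of squares, which the composition rule
  covers.\<close>

lemma C1_on_mult:
  assumes "C1_on S f" "C1_on S g" shows "C1_on S (\<lambda>x. f x * g x)"
proof -
  have eq: "f x * g x = (1/4) * ((f x + g x)\<^sup>2 - (f x - g x)\<^sup>2)" for x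
    by (simp add: power2_eq_square algebra_simps)
  show ?thesis unfolding eq
    by (intro C1_on_cmult C1_on_diff C1_on_power2 C1_on_add assms)
qed

lemma C1_on_divide_const:
  assumes "C1_on S f" shows "C1_on S (\<lambda>x. f x / c)"
  using C1_on_cmult[OF assms, of "1/c"] by simp

text \<open>Provides a one-sided penalty: squaring smooths the kink of the positive part.\<close>

lemma has_real_derivative_max0_power2:
  "((\<lambda>x::real. (max 0 x)\<^sup>2) has_real_derivative 2 * max 0 x) (at x)"
proof -
  consider "x < 0" | "x = 0" | "x > 0" by linarith
  then show ?thesis
  proof cases
    case 1
    then have "((\<lambda>x::real. (max 0 x)\<^sup>2) has_real_derivative 0) (at x)"
      by (intro has_field_derivative_transform_within_open[OF DERIV_const[of 0], of "{..<0}"]) auto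
    with 1 show ?thesis by simp
  next
    case 2
    \<comment> \<open>At the kink, Caratheodory's criterion applies with slope function
      \<open>max 0\<close>, which is continuous and is 0 there.\<close>
    have "(max 0 z)\<^sup>2 = max 0 z * z" for z :: real
      by (simp add: max_def power2_eq_square)
    then show ?thesis
      unfolding CARAT_DERIV using 2
      by (intro exI[of _ "max 0"]) (auto intro!: continuous_intros)
  next
    case 3
    have "((\<lambda>x::real. x\<^sup>2) has_real_derivative 2 * x) (at x)"
      by (auto intro!: derivative_eq_intros)
    then have "((\<lambda>x::real. (max 0 x)\<^sup>2) has_real_derivative 2 * x) (at x)"
      by (rule has_field_derivative_transform_within_open[where S = "{0<..}"]) (use 3 in auto)
    with 3 show ?thesis by simp
  qed
qed

lemma C1_on_max0_power2:
  assumes "C1_on S f" shows "C1_on S (\<lambda>x. (max 0 (f x))\<^sup>2)"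
  by (rule C1_on_compose[OF assms has_real_derivative_max0_power2]) (intro continuous_intros)

lemmas C1_on_heis_coords =
  C1_on_bounded_linear[OF bounded_linear_fst]
  C1_on_bounded_linear[OF bounded_linear_compose[OF bounded_linear_fst bounded_linear_snd]]
  C1_on_bounded_linear[OF bounded_linear_compose[OF bounded_linear_snd bounded_linear_snd]]

lemmas C1_on_intros = C1_on_const C1_on_add C1_on_diff C1_on_mult C1_on_power2 C1_on_max0_power2
  C1_on_divide_const C1_on_heis_coords

lemma norm_heis_power2: "(norm (a :: heis))\<^sup>2 = (fst a)\<^sup>2 + (fst (snd a))\<^sup>2 + (snd (snd a))\<^sup>2"
  by (cases a) (simp add: norm_Pair)

text \<open>The curve is straight, with velocity \<open>e\<close> equal to the combination of the
  fields X1 and X2 at \<open>p\<close> with coefficients \<open>v\<close>. The chain rule then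
  reduces questions about \<open>hgrad\<close> to calculus in one variable.\<close>

lemma hgrad_directional:
  assumes "C1_on \<Omega> \<phi>" "p \<in> \<Omega>"
  shows "((\<lambda>t. \<phi> (p \<odot> hvec (t *\<^sub>R v))) has_real_derivative hgrad \<phi> p \<bullet> v) (at 0)"
proof -
  obtain x y z where p: "p = (x, y, z)" by (cases p)
  obtain v1 v2 where v: "v = (v1, v2)" by (cases v)
  obtain D where D: "(\<phi> has_derivative D) (at p)"
    using assms unfolding C1_on_def by blast
  then have fd: "frechet_derivative \<phi> (at p) = D" and lin: "linear D"
    by (metis frechet_derivative_at) (rule has_derivative_linear[OF D])
  define e where "e = (v1, v2, (x * v2 - v1 * y) / 2)"
  have eq: "p \<odot> hvec (t *\<^sub>R v) = p + t *\<^sub>R e" for t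
    by (simp add: p v e_def hvec_def algebra_simps)
  have De: "D e = hgrad \<phi> p \<bullet> v"
  proof -
    have "e = v1 *\<^sub>R (1, 0, 0) + v2 *\<^sub>R (0, 1, 0) + ((x * v2 - v1 * y) / 2) *\<^sub>R (0, 0, 1)"
      by (simp add: e_def)
    then have "D e = v1 * D (1, 0, 0) + v2 * D (0, 1, 0) + ((x * v2 - v1 * y) / 2) * D (0, 0, 1)"
      by (simp only: linear_add[OF lin] linear_scale[OF lin] real_scaleR_def)
    then show ?thesis by (simp add: hgrad_def p v fd[unfolded p] Let_def field_simps)
  qed
  have "((\<lambda>t. p + t *\<^sub>R e) has_derivative (\<lambda>t. t *\<^sub>R e)) (at 0)"
    by (auto intro!: derivative_eq_intros)
  then have "((\<lambda>t. \<phi> (p + t *\<^sub>R e)) has_derivative (\<lambda>t. D (t *\<^sub>R e))) (at 0)"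
    using has_derivative_compose[of "\<lambda>t. p + t *\<^sub>R e" "\<lambda>t. t *\<^sub>R e" 0 UNIV \<phi> D] D by simp
  then show ?thesis
    unfolding has_field_derivative_def eq De[symmetric] linear_scale[OF lin]
    by (simp add: mult.commute[of _ "D e"])
qed

section \<open>Comparison\<close>

text \<open>A nonpositive supremum would give \<open>f p \<le> u p\<close>. So some point of the
  weak sublevel set pairs positively with the gradient, and \<open>v\<close> is the horizontal
  displacement to it.\<close>

lemma hj_supersolution_direction:
  assumes "hj_supersolution \<Omega> f u" "p \<in> \<Omega>" "C1_on \<Omega> \<phi>"
    and "\<And>q. q \<in> \<Omega> \<Longrightarrow> u p - \<phi> p \<le> u q - \<phi> q" and "u p < f p"
  obtains v where "p \<odot> hvec v \<in> \<Omega>" "u (p \<odot> hvec v) \<le> u p" "hgrad \<phi> p \<bullet> v > 0"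
proof -
  have *: "ereal (f p) \<le> ereal (u p) + hsup (weak_sublevel \<Omega> u p) p (hgrad \<phi> p)"
    using assms unfolding hj_supersolution_def by blast
  have "0 < hsup (weak_sublevel \<Omega> u p) p (hgrad \<phi> p)"
  proof (rule ccontr)
    assume "\<not> ?thesis"
    then have "ereal (u p) + hsup (weak_sublevel \<Omega> u p) p (hgrad \<phi> p) \<le> ereal (u p) + 0"
      by (intro add_left_mono) simp
    with * have "ereal (f p) \<le> ereal (u p)" by (metis add.right_neutral order_trans)
    with assms(5) show False by simp
  qed
  then obtain \<xi> where "\<xi> \<in> weak_sublevel \<Omega> u p"
    and \<xi>: "0 < ereal (hgrad \<phi> p \<bullet> hpart (heis_inv p \<odot> \<xi>))"
    unfolding hsup_def less_SUP_iff by blast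
  then obtain v where "\<xi> = p \<odot> hvec v" "\<xi> \<in> \<Omega>" "u \<xi> \<le> u p"
    by (auto simp: weak_sublevel_def horiz_plane_iff)
  with \<xi> show thesis by (intro that[of v]) auto
qed

text \<open>A single strictly lower point bounds the supremum from below. The gradient must be
  nonzero, since otherwise the definition puts 0 in place of the supremum.\<close>

lemma hj_subsolution_direction:
  assumes "hj_subsolution \<Omega> f u" "p \<in> \<Omega>" "C1_on \<Omega> \<phi>"
    and "\<And>q. q \<in> \<Omega> \<Longrightarrow> u q - \<phi> q \<le> u p - \<phi> p" and "hgrad \<phi> p \<noteq> 0"
    and "p \<odot> hvec v \<in> \<Omega>" "u (p \<odot> hvec v) < u p"
  shows "u p + hgrad \<phi> p \<bullet> v \<le> f p"
proof -
  have "ereal (u p) + (if hgrad \<phi> p = 0 then 0 else hsup (strict_sublevel \<Omega> u p) p (hgrad \<phi> p))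
      \<le> ereal (f p)"
    using assms(1-4) unfolding hj_subsolution_def by blast
  then have *: "ereal (u p) + hsup (strict_sublevel \<Omega> u p) p (hgrad \<phi> p) \<le> ereal (f p)"
    using assms(5) by simp
  have "p \<odot> hvec v \<in> strict_sublevel \<Omega> u p"
    using assms(6,7) by (simp add: strict_sublevel_def)
  then have "ereal (hgrad \<phi> p \<bullet> v) \<le> hsup (strict_sublevel \<Omega> u p) p (hgrad \<phi> p)"
    unfolding hsup_def by (intro SUP_upper2) auto
  then have "ereal (u p) + ereal (hgrad \<phi> p \<bullet> v)
      \<le> ereal (u p) + hsup (strict_sublevel \<Omega> u p) p (hgrad \<phi> p)"
    by (rule add_left_mono)
  with * have "ereal (u p) + ereal (hgrad \<phi> p \<bullet> v) \<le> ereal (f p)" by (rule order_trans[rotated])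
  then show ?thesis by simp
qed

text \<open>Doubling of variables with the group difference \<open>a\<close> as second variable. At
  a positive maximum the penalty yields a test function for \<open>v\<close>, and the supersolution
  property yields a direction in which that function increases. This contradicts h-quasiconvexity of
  a left translate of \<open>g\<close>. Taking \<open>g\<close> on the whole space lets translates
  leave \<open>\<Omega>\<close>.\<close>

lemma h_quasiconvex_le_supersolution:
  assumes "bounded \<Omega>"
    and qc: "h_quasiconvex_on UNIV g" and g: "continuous_on UNIV g" and gK: "\<And>p. g p \<le> K"
    and left: "\<And>e. e > 0 \<Longrightarrow> \<exists>d>0. \<forall>a p. norm a < d \<longrightarrow> g (a \<odot> p) \<le> g p + e"
    and v: "continuous_on (closure \<Omega>) v" and vK: "\<And>p. p \<in> frontier \<Omega> \<Longrightarrow> v p = K"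
    and "open \<Omega>" and super: "hj_supersolution \<Omega> f v" and gf: "\<And>p. p \<in> \<Omega> \<Longrightarrow> g p \<le> f p"
    and p: "p \<in> closure \<Omega>"
  shows "g p \<le> v p"
proof (rule ccontr)
  assume "\<not> g p \<le> v p"
  define m0 where "m0 = g p - v p"
  have m0: "m0 > 0" using \<open>\<not> g p \<le> v p\<close> by (simp add: m0_def)
  have cpt: "compact (closure \<Omega>)" using assms(1) by (simp add: compact_closure)
  obtain V where V: "\<And>q. q \<in> closure \<Omega> \<Longrightarrow> V \<le> v q"
    using compact_continuous_image[OF v cpt] compact_imp_bounded bounded_imp_bdd_below
    by (metis bdd_below.E image_eqI)
  \<comment> \<open>Allowing only half of the excess \<open>m0\<close> here leaves a strict
    inequality between \<open>v\<close> and \<open>f\<close> at the maximum point.\<close>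
  obtain d where d: "d > 0" "\<And>a p. norm a < d \<Longrightarrow> g (a \<odot> p) \<le> g p + m0 / 2"
    using left[of "m0 / 2"] m0 by auto
  \<comment> \<open>The penalty at distance \<open>d\<close> exceeds \<open>K - V\<close>, the
    largest possible value of \<open>g - v\<close>, so no maximum can occur there.\<close>
  define C where "C = (\<bar>K - V\<bar> + 1) / d\<^sup>2"
  have C: "C > 0" using d by (simp add: C_def)
  define F where "F a q = g (a \<odot> q) - C * (norm a)\<^sup>2 - v q" for a q
  have far: "F a q < 0" if "norm a \<ge> d" "q \<in> closure \<Omega>" for a q
  proof -
    have "d\<^sup>2 \<le> (norm a)\<^sup>2" using that d by (intro power_mono) auto
    then have "C * d\<^sup>2 \<le> C * (norm a)\<^sup>2" using C by simp
    moreover have "C * d\<^sup>2 = \<bar>K - V\<bar> + 1" using d by (simp add: C_def)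
    ultimately show ?thesis using gK[of "a \<odot> q"] V[OF that(2)] unfolding F_def by linarith
  qed
  have "continuous_on (cball 0 d \<times> closure \<Omega>) (\<lambda>x. F (fst x) (snd x))"
    unfolding F_def
    by (intro continuous_intros continuous_on_compose2[OF g] continuous_on_compose2[OF v]) auto
  moreover have "compact (cball (0::heis) d \<times> closure \<Omega>)" using cpt by (intro compact_Times) auto
  moreover have "cball (0::heis) d \<times> closure \<Omega> \<noteq> {}" using p d by auto
  ultimately have "\<exists>x\<in>cball 0 d \<times> closure \<Omega>. \<forall>y\<in>cball 0 d \<times> closure \<Omega>.
      F (fst y) (snd y) \<le> F (fst x) (snd x)"
    by (intro continuous_attains_sup)
  then obtain x where x: "x \<in> cball 0 d \<times> closure \<Omega>"
    "\<And>y. y \<in> cball 0 d \<times> closure \<Omega> \<Longrightarrow> F (fst y) (snd y) \<le> F (fst x) (snd x)" by blast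
  define a0 q0 where "a0 = fst x" and "q0 = snd x"
  have q0: "q0 \<in> closure \<Omega>" using x(1) unfolding q0_def by (rule mem_Times_iff[THEN iffD1, THEN conjunct2])
  have max0: "F a q \<le> F a0 q0" if "norm a \<le> d" "q \<in> closure \<Omega>" for a q
    using x(2)[of "(a, q)"] that unfolding a0_def q0_def by (simp only: mem_Times_iff mem_cball_0 fst_conv snd_conv)
  define m where "m = F a0 q0"
  have m: "m \<ge> m0" using max0[of 0 p] p d by (simp add: m_def F_def m0_def)
  \<comment> \<open>For large \<open>a\<close> the value is negative while \<open>m\<close> is
    positive, so the maximum over the compact set is one over all \<open>a\<close>.\<close>
  have max: "F a q \<le> m" if "q \<in> closure \<Omega>" for a q
    using max0[of a q] far[of a q] that m m0 by (cases "norm a \<le> d") (auto simp: m_def)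
  have a0: "norm a0 < d"
    using far[OF _ q0, of a0] m m0 unfolding m_def by linarith
  have "q0 \<notin> frontier \<Omega>"
  proof
    assume "q0 \<in> frontier \<Omega>"
    moreover have "0 \<le> C * (norm a0)\<^sup>2" using C by simp
    ultimately have "m \<le> 0" using vK[of q0] gK[of "a0 \<odot> q0"] unfolding m_def F_def by linarith
    with m m0 show False by simp
  qed
  then have q0': "q0 \<in> \<Omega>" using q0 \<open>open \<Omega>\<close> by (simp add: frontier_def interior_open)
  define p0 where "p0 = a0 \<odot> q0"
  \<comment> \<open>Freezing the first point at \<open>p0\<close> and varying only \<open>q\<close>
    gives a function that touches \<open>v\<close> from below at \<open>q0\<close>, up to a
    constant.\<close>
  define \<phi> where "\<phi> q = g p0 - C * (norm (p0 \<odot> heis_inv q))\<^sup>2" for q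
  have C1: "C1_on \<Omega> \<phi>"
  proof -
    obtain x y z where xyz: "p0 = (x, y, z)" by (cases p0)
    have "\<phi> = (\<lambda>q. g p0 - C * ((x - fst q)\<^sup>2 + (y - fst (snd q))\<^sup>2
        + (z - snd (snd q) + (fst q * y - x * fst (snd q)) / 2)\<^sup>2))"
      by (auto simp: \<phi>_def norm_heis_power2 xyz)
    then show ?thesis by (simp only:) (intro C1_on_intros)
  qed
  have \<phi>F: "\<phi> q = F (p0 \<odot> heis_inv q) q + v q" for q
    by (simp add: \<phi>_def F_def heis_mult_assoc)
  have a0': "p0 \<odot> heis_inv q0 = a0" by (simp add: p0_def heis_mult_assoc)
  have "v q0 - \<phi> q0 \<le> v q - \<phi> q" if "q \<in> \<Omega>" for q
    using max[of q "p0 \<odot> heis_inv q"] that closure_subset[of \<Omega>]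
    by (auto simp: \<phi>F a0' m_def)
  \<comment> \<open>From \<open>m0 \<le> m \<le> g q0 + m0 / 2 - v q0\<close> and
    \<open>g q0 \<le> f q0\<close>.\<close>
  moreover have "v q0 < f q0"
    using m m0 d(2)[OF a0, of q0] gf[OF q0'] C unfolding m_def F_def
    by (smt (verit) field_sum_of_halves mult_nonneg_nonneg zero_le_power2)
  ultimately obtain h where h: "q0 \<odot> hvec h \<in> \<Omega>" "v (q0 \<odot> hvec h) \<le> v q0" "hgrad \<phi> q0 \<bullet> h > 0"
    using hj_supersolution_direction[OF super q0' C1] by blast
  from hgrad_directional[OF C1 q0', of h] h(3)
  obtain e where e: "e > 0" "\<And>t. 0 < t \<Longrightarrow> t < e \<Longrightarrow> \<phi> q0 < \<phi> (q0 \<odot> hvec (t *\<^sub>R h))"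
    using DERIV_pos_inc_right[of "\<lambda>t. \<phi> (q0 \<odot> hvec (t *\<^sub>R h))" _ 0] by auto
  define t where "t = min (e / 2) 1"
  have t: "0 < t" "t < e" "t \<le> 1" using e(1) by (auto simp: t_def)
  define w where "w = q0 \<odot> hvec (t *\<^sub>R h)"
  \<comment> \<open>This \<open>a\<close> carries \<open>w\<close> to \<open>p0\<close>. It now
    stays fixed while the whole segment from \<open>q0\<close> to \<open>q0 \<odot> hvec h\<close>
    is translated. Maximality at both ends, with \<open>v\<close> at the far end at most
    \<open>v q0\<close>, bounds the translated \<open>g\<close> by what \<open>\<phi> q0\<close>
    allows, but at \<open>w\<close> it is larger.\<close>
  define a where "a = p0 \<odot> heis_inv w"
  have "\<phi> q0 < g (a \<odot> w) - C * (norm a)\<^sup>2"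
    using e(2)[OF t(1,2)] by (simp add: \<phi>F[of w] F_def w_def[symmetric] a_def)
  moreover have "g (a \<odot> w) \<le> max (g (a \<odot> q0)) (g (a \<odot> (q0 \<odot> hvec h)))"
    using qc t unfolding h_quasiconvex_on_iff w_def
    by (metis UNIV_I heis_mult_assoc less_imp_le)
  moreover have "g (a \<odot> q0) - C * (norm a)\<^sup>2 \<le> \<phi> q0"
    using max[OF q0, of a] by (simp add: F_def \<phi>F a0' m_def)
  moreover have "g (a \<odot> (q0 \<odot> hvec h)) - C * (norm a)\<^sup>2 \<le> \<phi> q0"
    using max[of "q0 \<odot> hvec h" a] h(1,2) closure_subset[of \<Omega>] by (auto simp: F_def \<phi>F a0' m_def)
  ultimately show False by linarith
qed

text \<open>At points touched from above the nonlocal term is nonnegative in effect. A steep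
  paraboloid produces such a point inside any ball where \<open>u\<close> exceeds
  \<open>f\<close>.\<close>

lemma hj_subsolution_le:
  assumes "open \<Omega>" and sub: "hj_subsolution \<Omega> f u"
    and f: "continuous_on \<Omega> f" and u: "continuous_on \<Omega> u" and uK: "\<And>q. q \<in> \<Omega> \<Longrightarrow> u q \<le> K"
    and p: "p \<in> \<Omega>"
  shows "u p \<le> f p"
proof -
  have touched: "u p \<le> f p" if p: "p \<in> \<Omega>" and C1: "C1_on \<Omega> \<phi>"
    and max: "\<And>q. q \<in> \<Omega> \<Longrightarrow> u q - \<phi> q \<le> u p - \<phi> p" for p \<phi>
  proof (cases "hgrad \<phi> p = 0")
    case True
    have "ereal (u p) + (if hgrad \<phi> p = 0 then 0 else hsup (strict_sublevel \<Omega> u p) p (hgrad \<phi> p))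
        \<le> ereal (f p)"
      using sub p C1 max unfolding hj_subsolution_def by blast
    with True show ?thesis by simp
  next
    case False
    \<comment> \<open>Moving against the gradient lowers \<open>\<phi>\<close>, hence strictly
      lowers \<open>u\<close> because \<open>u - \<phi>\<close> is maximal at \<open>p\<close>. Such
      points are competitors in the supremum, and their pairings tend to 0 as the step
      shrinks.\<close>
    define v where "v = - hgrad \<phi> p"
    have v: "hgrad \<phi> p \<bullet> v < 0" using False by (simp add: v_def)
    obtain e where e: "e > 0" "\<And>t. 0 < t \<Longrightarrow> t < e \<Longrightarrow> \<phi> (p \<odot> hvec (t *\<^sub>R v)) < \<phi> p"
      using DERIV_neg_dec_right[OF hgrad_directional[OF C1 p, of v] v] by auto
    have "continuous_on UNIV (\<lambda>t::real. p \<odot> hvec (t *\<^sub>R v))"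
      by (intro continuous_intros)
    then have "open ((\<lambda>t::real. p \<odot> hvec (t *\<^sub>R v)) -` \<Omega>)"
      using \<open>open \<Omega>\<close> by (simp add: open_vimage)
    moreover have "0 \<in> (\<lambda>t::real. p \<odot> hvec (t *\<^sub>R v)) -` \<Omega>" using p by simp
    ultimately obtain d where d: "d > 0" "ball 0 d \<subseteq> (\<lambda>t::real. p \<odot> hvec (t *\<^sub>R v)) -` \<Omega>"
      using open_contains_ball by blast
    have *: "u p + t * (hgrad \<phi> p \<bullet> v) \<le> f p" if t: "0 < t" "t < min d e" for t
    proof -
      have "t \<in> ball 0 d" using t by simp
      then have in\<Omega>: "p \<odot> hvec (t *\<^sub>R v) \<in> \<Omega>" using d(2) by blast
      have "u (p \<odot> hvec (t *\<^sub>R v)) < u p" using max[OF in\<Omega>] e(2)[of t] t by simp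
      then show ?thesis
        using hj_subsolution_direction[OF sub p C1 max False in\<Omega>] by simp
    qed
    have "((\<lambda>t. u p + t * (hgrad \<phi> p \<bullet> v)) \<longlongrightarrow> u p + 0 * (hgrad \<phi> p \<bullet> v)) (at_right 0)"
      by (intro tendsto_intros)
    moreover have "eventually (\<lambda>t. u p + t * (hgrad \<phi> p \<bullet> v) \<le> f p) (at_right 0)"
      using * d(1) e(1) by (auto simp: eventually_at_right_field intro!: exI[of _ "min d e"])
    ultimately have "u p + 0 * (hgrad \<phi> p \<bullet> v) \<le> f p"
      by (rule tendsto_upperbound) simp
    then show ?thesis by simp
  qed
  show ?thesis
  proof (rule ccontr)
    assume neg: "\<not> u p \<le> f p"
    have "open (\<Omega> \<inter> (\<lambda>q. u q - f q) -` {0<..})"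
      by (intro continuous_open_preimage continuous_on_diff u f \<open>open \<Omega>\<close> open_greaterThan)
    moreover have "\<Omega> \<inter> (\<lambda>q. u q - f q) -` {0<..} = {q \<in> \<Omega>. 0 < u q - f q}" by blast
    ultimately have "open {q \<in> \<Omega>. 0 < u q - f q}" by metis
    moreover have "p \<in> {q \<in> \<Omega>. 0 < u q - f q}" using neg p by simp
    ultimately obtain r where r: "r > 0" "cball p r \<subseteq> {q \<in> \<Omega>. 0 < u q - f q}"
      unfolding open_contains_cball by blast
    \<comment> \<open>Steep enough that outside the ball \<open>u - \<phi>\<close> stays below its
      value \<open>u p\<close> at the centre.\<close>
    define C where "C = (\<bar>K - u p\<bar> + 1) / r\<^sup>2"
    have C: "C > 0" "C * r\<^sup>2 = \<bar>K - u p\<bar> + 1" using r(1) by (auto simp: C_def)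
    define \<phi> where "\<phi> q = C * (norm (q - p))\<^sup>2" for q
    have "continuous_on (cball p r) (\<lambda>q. u q - \<phi> q)"
      unfolding \<phi>_def using r(2) by (intro continuous_intros continuous_on_subset[OF u]) auto
    moreover have "cball p r \<noteq> {}" using r(1) by simp
    ultimately have "\<exists>p1\<in>cball p r. \<forall>q\<in>cball p r. u q - \<phi> q \<le> u p1 - \<phi> p1"
      by (intro continuous_attains_sup compact_cball)
    then obtain p1 where p1: "p1 \<in> cball p r" "\<And>q. q \<in> cball p r \<Longrightarrow> u q - \<phi> q \<le> u p1 - \<phi> p1"
      by blast
    have "u p \<le> u p1 - \<phi> p1" using p1(2)[of p] r(1) by (simp add: \<phi>_def)
    moreover have "u q - \<phi> q \<le> u p" if "q \<in> \<Omega>" "q \<notin> cball p r" for q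
    proof -
      have "r\<^sup>2 \<le> (norm (q - p))\<^sup>2"
        using that r(1) by (intro power_mono) (auto simp: dist_norm norm_minus_commute)
      then have "C * r\<^sup>2 \<le> \<phi> q" using C(1) by (simp add: \<phi>_def)
      then show ?thesis using C(2) uK[OF that(1)] by linarith
    qed
    ultimately have max: "u q - \<phi> q \<le> u p1 - \<phi> p1" if "q \<in> \<Omega>" for q
      using that p1(2) by (meson order_trans)
    have "\<phi> = (\<lambda>q. C * ((fst q - fst p)\<^sup>2 + (fst (snd q) - fst (snd p))\<^sup>2 + (snd (snd q) - snd (snd p))\<^sup>2))"
      by (auto simp add: \<phi>_def norm_heis_power2)
    then have "C1_on \<Omega> \<phi>" by (simp only:) (intro C1_on_intros)
    moreover have "p1 \<in> \<Omega>" "0 < u p1 - f p1" using p1(1) r(2) by blast+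
    ultimately show False using touched[OF _ _ max] by force
  qed
qed

section \<open>The limit is h-quasiconvex\<close>

text \<open>If all \<open>u n\<close> stayed at least \<open>l'\<close> at the intermediate point,
  the maximum of \<open>u n - \<phi>\<close> would drop by at least \<open>a * e\<close> at each
  step from \<open>N\<close> on, against the lower bound \<open>L\<close>.\<close>

lemma hj_iteration_segment:
  assumes "open \<Omega>" "bounded \<Omega>" "h_convex \<Omega>"
    and u: "\<And>n. continuous_on (closure \<Omega>) (u n)"
    and K: "\<And>n q. q \<in> closure \<Omega> \<Longrightarrow> u n q \<le> K"
    and L: "\<And>n q. q \<in> \<Omega> \<Longrightarrow> L \<le> u n q"
    and dec: "\<And>n q. q \<in> closure \<Omega> \<Longrightarrow> u (Suc n) q \<le> u n q"
    and sub: "\<And>n. hj_subsolution \<Omega> (u n) (u (Suc n))"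
    and p: "p \<in> \<Omega>" and q: "p \<odot> hvec v \<in> \<Omega>" and t: "0 \<le> t" "t \<le> 1"
    and l: "u N p < l" "u N (p \<odot> hvec v) < l" "l < l'"
  shows "\<exists>n. u n (p \<odot> hvec (t *\<^sub>R v)) < l'"
proof (cases "v = 0")
  case True
  then show ?thesis using l by (intro exI[of _ N]) simp
next
  case False
  then have vv: "v \<bullet> v > 0" by simp
  show ?thesis
  proof (rule ccontr)
    assume "\<not> ?thesis"
    then have w: "l' \<le> u n (p \<odot> hvec (t *\<^sub>R v))" for n by (meson not_le)
    have decN: "u n z \<le> u N z" if "n \<ge> N" "z \<in> closure \<Omega>" for n z
      using that(1) by (induction rule: dec_induct) (auto intro: order_trans[OF dec[OF that(2)]])
    define s where "s z = (hpart (heis_inv p \<odot> z) \<bullet> v) / (v \<bullet> v)" for z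
    \<comment> \<open>\<open>s\<close> is the coordinate along the line through \<open>p\<close> in direction \<open>v\<close>, and \<open>A\<close> is constant along
      the flow of the left-invariant field of direction \<open>v\<close>; hence \<open>\<phi>\<close> below has slope exactly \<open>a\<close>
      in that direction wherever \<open>0 < s < 1\<close>, however large \<open>C\<close> is.\<close>
    define A where "A z = heis_inv p \<odot> z \<odot> hvec (- s z *\<^sub>R v)" for z
    \<comment> \<open>Here \<open>A z\<close> is the offset from the line, so \<open>D\<close>
      vanishes exactly on the segment from \<open>p\<close> to
      \<open>p \<odot> hvec v\<close>.\<close>
    define D where "D z = (norm (A z))\<^sup>2 + ((max 0 (- s z))\<^sup>2 + (max 0 (s z - 1))\<^sup>2)" for z
    have decomp: "z = p \<odot> A z \<odot> hvec (s z *\<^sub>R v)" for z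
    proof -
      have "p \<odot> A z \<odot> hvec (s z *\<^sub>R v) = (p \<odot> heis_inv p) \<odot> z \<odot> (hvec (- s z *\<^sub>R v) \<odot> hvec (s z *\<^sub>R v))"
        unfolding A_def by (simp only: heis_mult_assoc)
      then show ?thesis by (simp only: hvec_scaleR_mult) simp
    qed
    have s_shift: "s (z \<odot> hvec (r *\<^sub>R v)) = s z + r" for z r
    proof -
      have "hpart (heis_inv p \<odot> (z \<odot> hvec (r *\<^sub>R v))) = hpart (heis_inv p \<odot> z) + r *\<^sub>R v"
        by (cases p; cases z; cases v) (simp add: hvec_def)
      then show ?thesis using vv by (simp add: s_def inner_add_left add_divide_distrib)
    qed
    have A_shift: "A (z \<odot> hvec (r *\<^sub>R v)) = A z" for z r
    proof -
      have "A (z \<odot> hvec (r *\<^sub>R v)) = heis_inv p \<odot> z \<odot> (hvec (r *\<^sub>R v) \<odot> hvec (- (s z + r) *\<^sub>R v))"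
        unfolding A_def s_shift by (simp only: heis_mult_assoc)
      then show ?thesis by (simp only: hvec_scaleR_mult) (simp add: A_def)
    qed
    have cs: "continuous_on S s" for S
      unfolding s_def by (intro continuous_intros) (use vv in auto)
    then have cA: "continuous_on S A" for S
      unfolding A_def by (intro continuous_intros)
    have cD: "continuous_on S D" for S
      unfolding D_def by (intro continuous_intros cs cA)
    have C1s: "C1_on S s" for S
    proof -
      obtain a b c where "p = (a, b, c)" by (cases p)
      then have "s = (\<lambda>z. ((fst z - a) * fst v + (fst (snd z) - b) * snd v) / (v \<bullet> v))"
        by (cases v) (auto simp: s_def)
      then show ?thesis by (simp only:) (intro C1_on_intros)
    qed
    have C1D: "C1_on S D" for S
    proof -
      obtain a b c where abc: "p = (a, b, c)" by (cases p)
      have "D = (\<lambda>z. ((fst z - a - s z * fst v)\<^sup>2 + (fst (snd z) - b - s z * snd v)\<^sup>2 +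
          (snd (snd z) - c + (fst z * b - a * fst (snd z)) / 2 +
            ((s z * fst v) * (fst (snd z) - b) - (fst z - a) * (s z * snd v)) / 2)\<^sup>2)
          + ((max 0 (0 - s z))\<^sup>2 + (max 0 (s z - 1))\<^sup>2))"
        unfolding D_def A_def norm_heis_power2
        by (cases v) (auto simp: abc hvec_def algebra_simps)
      then show ?thesis by (simp only:) (intro C1_on_intros C1s)
    qed
    define W where "W = {z \<in> \<Omega>. u N z < l}"
    have "open (\<Omega> \<inter> u N -` {..<l})"
      by (intro continuous_open_preimage continuous_on_subset[OF u closure_subset] \<open>open \<Omega>\<close> open_lessThan)
    moreover have "\<Omega> \<inter> u N -` {..<l} = W" by (auto simp: W_def)
    ultimately have "open W" by metis
    \<comment> \<open>The low set \<open>W\<close> seen in the coordinates offset and parameter,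
      centred at the two ends \<open>r = 0\<close> and \<open>r = 1\<close>. One radius
      \<open>e\<close> then serves both ends.\<close>
    define W' where "W' r = (\<lambda>x. p \<odot> fst x \<odot> hvec ((r + snd x) *\<^sub>R v)) -` W" for r :: real
    have "open (W' 0 \<inter> W' 1)"
      unfolding W'_def by (intro open_Int open_vimage \<open>open W\<close> continuous_intros)
    moreover have "(0, 0) \<in> W' 0 \<inter> W' 1" using p q l by (simp add: W'_def W_def)
    ultimately obtain d where d: "d > 0" "ball (0, 0) d \<subseteq> W' 0 \<inter> W' 1"
      using open_contains_ball by blast
    define e where "e = min (d / 2) (1 / 2)"
    have e: "e > 0" "e < 1" using d by (auto simp: e_def)
    have near: "p \<odot> a \<odot> hvec (r *\<^sub>R v) \<in> W" "p \<odot> a \<odot> hvec ((1 + r) *\<^sub>R v) \<in> W"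
      if "norm a < e" "\<bar>r\<bar> < e" for a r
    proof -
      have "norm (a, r) \<le> norm a + norm r" by (rule norm_Pair_le)
      also have "\<dots> < d" using that by (simp add: e_def)
      finally have "(a, r) \<in> ball (0, 0) d" by (simp only: mem_ball dist_norm zero_prod_def[symmetric] diff_0 norm_minus_cancel)
      then show "p \<odot> a \<odot> hvec (r *\<^sub>R v) \<in> W" "p \<odot> a \<odot> hvec ((1 + r) *\<^sub>R v) \<in> W"
        using d(2) by (auto simp: W'_def)
    qed
    have cpt: "compact (closure \<Omega>)" using \<open>bounded \<Omega>\<close> by (simp add: compact_closure)
    have "bounded (s ` closure \<Omega>)" using compact_continuous_image[OF cs cpt] compact_imp_bounded by blast
    then obtain S where S: "S > 0" "\<And>z. z \<in> closure \<Omega> \<Longrightarrow> \<bar>s z\<bar> \<le> S"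
      by (auto simp: bounded_pos)
    \<comment> \<open>The slope is so small that over the whole domain the linear term cannot bridge
      the gap between \<open>l\<close> and \<open>l'\<close>.\<close>
    define a where "a = ((l' - l) / 2) / (1 + S)"
    have "1 + S \<noteq> 0" using S(1) by linarith
    then have "a * (1 + S) = (l' - l) / 2" unfolding a_def
      by (rule nonzero_eq_divide_eq[THEN iffD1, OF _ refl])
    moreover have "(l' - l) / 2 < l' - l" using l(3) by simp
    ultimately have "a * (1 + S) < l' - l" by (simp only:)
    moreover have "a > 0" using l(3) S(1) by (simp add: a_def)
    ultimately have a: "a > 0" "a * (1 + S) < l' - l" by blast+
    \<comment> \<open>Large enough that a maximum point of \<open>u (Suc n) - \<phi>\<close> must
      satisfy \<open>D z < e\<^sup>2\<close>, because \<open>u (Suc n) \<le> K\<close>.\<close>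
    define C where "C = (\<bar>K - l'\<bar> + a * (1 + S) + 1) / e\<^sup>2"
    have "0 < a * (1 + S)" using a(1) S(1) by simp
    then have C: "C > 0" "C * e\<^sup>2 = \<bar>K - l'\<bar> + a * (1 + S) + 1"
      using e(1) unfolding C_def by (simp_all add: add_nonneg_pos)
    define \<phi> where "\<phi> z = a * s z + C * D z" for z
    have C1: "C1_on \<Omega> \<phi>" unfolding \<phi>_def by (intro C1_on_add C1_on_mult C1_on_const C1s C1D)
    have c\<phi>: "continuous_on (closure \<Omega>) \<phi>" unfolding \<phi>_def by (intro continuous_intros cs cD)
    define w0 where "w0 = p \<odot> hvec (t *\<^sub>R v)"
    have w0: "w0 \<in> \<Omega>" unfolding w0_def using h_convex_mult_hvec assms(3) p q t by blast
    have sp: "s p = 0" by (simp add: s_def hpart_eq zero_prod_def[symmetric])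
    have "A p = 0" by (simp add: A_def sp)
    \<comment> \<open>On the segment the penalty is 0 and only the slope term \<open>a * t\<close>
      remains.\<close>
    then have \<phi>w0: "\<phi> w0 \<le> a" using a(1) t
      by (simp add: \<phi>_def D_def w0_def A_shift s_shift sp max_def)
    \<comment> \<open>The estimate behind the drop: a maximum point lies beside the middle of the
      segment, and the far end of the parallel segment through it is strictly lower, at parameter
      distance at least \<open>e\<close>.\<close>
    have gap: "u (Suc n) z + a * e \<le> u n z" if n: "n \<ge> N" and z: "z \<in> closure \<Omega>"
      and max: "\<And>y. y \<in> closure \<Omega> \<Longrightarrow> u (Suc n) y - \<phi> y \<le> u (Suc n) z - \<phi> z" for n z
    proof -
      have "u (Suc n) w0 - \<phi> w0 \<le> u (Suc n) z - \<phi> z" using max w0 closure_subset by blast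
      with \<phi>w0 w[of "Suc n"] have *: "l' - a \<le> u (Suc n) z - \<phi> z" unfolding w0_def by linarith
      have "\<bar>a * s z\<bar> \<le> a * S" using S(2)[OF z] a(1) by (simp add: abs_mult)
      then have **: "l' - a * (1 + S) + C * D z \<le> u (Suc n) z" using *
        by (simp add: \<phi>_def algebra_simps)
      then have "C * D z \<le> C * e\<^sup>2 - 1" using K[OF z, of "Suc n"] C(2) by linarith
      then have "C * D z < C * e\<^sup>2" by linarith
      then have D: "D z < e\<^sup>2" using C(1) by simp
      have "0 \<le> D z" by (simp add: D_def)
      then have "0 \<le> C * D z" using C(1) by simp
      with ** a(2) have lz: "l < u (Suc n) z" by linarith
      \<comment> \<open>A value above \<open>l\<close> excludes \<open>W\<close>, which contains
        neighbourhoods of both ends. Since \<open>z\<close> is within \<open>e\<close> of the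
        segment, its parameter lies between \<open>e\<close> and \<open>1 - e\<close>.\<close>
      have notW: "z \<notin> W" using lz decN[OF _ z, of "Suc n"] n by (auto simp: W_def)
      have "(norm (A z))\<^sup>2 < e\<^sup>2" "(max 0 (- s z))\<^sup>2 < e\<^sup>2" "(max 0 (s z - 1))\<^sup>2 < e\<^sup>2"
        using D unfolding D_def by (smt (verit) zero_le_power2)+
      then have Az: "norm (A z) < e" and s1: "- s z < e" "s z - 1 < e"
        using e(1) by (auto dest!: power_less_imp_less_base)
      have "\<not> \<bar>s z\<bar> < e" using near(1)[OF Az, of "s z"] notW decomp[of z] by metis
      moreover have "\<not> \<bar>s z - 1\<bar> < e" using near(2)[OF Az, of "s z - 1"] notW decomp[of z]
        by (metis add.commute diff_add_cancel)
      ultimately have sz: "e \<le> s z" "s z \<le> 1 - e" using s1 by linarith+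
      have endW: "p \<odot> A z \<in> W" "p \<odot> A z \<odot> hvec v \<in> W"
        using near[OF Az, of 0] e by auto
      \<comment> \<open>The maximum was taken over the closure. The point is interior because it
        lies on a horizontal segment with both ends in \<open>W\<close>, and \<open>\<Omega>\<close>
        is h-convex.\<close>
      then have z\<Omega>: "z \<in> \<Omega>"
        using h_convex_mult_hvec[OF assms(3), of "p \<odot> A z" v "s z"] sz e decomp[of z]
        by (simp add: W_def)
      \<comment> \<open>The far end of the parallel segment through \<open>z\<close>; it lies in
        \<open>W\<close>, so it belongs to the strict sublevel set of \<open>z\<close>.\<close>
      define q' where "q' = z \<odot> hvec ((1 - s z) *\<^sub>R v)"
      have "q' = p \<odot> A z \<odot> (hvec (s z *\<^sub>R v) \<odot> hvec ((1 - s z) *\<^sub>R v))"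
        unfolding q'_def by (subst (1) decomp) (simp only: heis_mult_assoc)
      then have "q' = p \<odot> A z \<odot> hvec v" by (simp only: hvec_scaleR_mult) simp
      then have q'W: "q' \<in> W" using endW by simp
      then have q'\<Omega>: "q' \<in> \<Omega>" by (simp add: W_def)
      have "u (Suc n) q' < l" using q'W decN[of "Suc n" q'] n closure_subset[of \<Omega>] by (force simp: W_def)
      then have less: "u (Suc n) q' < u (Suc n) z" using lz by linarith
      have "((\<lambda>r. \<phi> (z \<odot> hvec (r *\<^sub>R v))) has_real_derivative a) (at 0)"
      proof (rule DERIV_cong_ev[THEN iffD1, OF refl _ refl])
        show "((\<lambda>r. a * (s z + r) + C * (norm (A z))\<^sup>2) has_real_derivative a) (at 0)"
          by (auto intro!: derivative_eq_intros)
        \<comment> \<open>For these \<open>r\<close> the parameter \<open>s z + r\<close> stays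
          between 0 and 1, where the one-sided penalties vanish.\<close>
        have "\<forall>\<^sub>F r in nhds (0::real). r \<in> {-e<..<e}"
          using e by (intro eventually_nhds_in_open) auto
        then show "\<forall>\<^sub>F r in nhds 0. a * (s z + r) + C * (norm (A z))\<^sup>2 = \<phi> (z \<odot> hvec (r *\<^sub>R v))"
        proof eventually_elim
          case (elim r)
          then have "max 0 (- (s z + r)) = 0" "max 0 (s z + r - 1) = 0" using sz by auto
          then show ?case by (simp add: \<phi>_def D_def A_shift s_shift)
        qed
      qed
      then have grad: "hgrad \<phi> z \<bullet> v = a"
        using hgrad_directional[OF C1 z\<Omega>, of v] DERIV_unique by blast
      then have "hgrad \<phi> z \<noteq> 0" using a(1) by auto
      then have "u (Suc n) z + hgrad \<phi> z \<bullet> ((1 - s z) *\<^sub>R v) \<le> u n z"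
        using hj_subsolution_direction[OF sub z\<Omega> C1, of n "(1 - s z) *\<^sub>R v"] max closure_subset[of \<Omega>]
          q'\<Omega> less unfolding q'_def by blast
      moreover have "a * e \<le> (1 - s z) * a" using sz a(1) by (simp add: mult.commute)
      ultimately show ?thesis using grad by simp
    qed
    have attains: "\<exists>z\<in>closure \<Omega>. \<forall>y\<in>closure \<Omega>. u n y - \<phi> y \<le> u n z - \<phi> z" for n
      using w0 closure_subset by (intro continuous_attains_sup cpt continuous_on_diff u c\<phi>) blast
    obtain B where B: "\<And>z. z \<in> closure \<Omega> \<Longrightarrow> u N z - \<phi> z \<le> B"
      using attains[of N] by blast
    have drop: "\<forall>z\<in>closure \<Omega>. u (N + k) z - \<phi> z \<le> B - real k * (a * e)" for k
    proof (induction k)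
      case 0
      then show ?case using B by simp
    next
      case (Suc k)
      obtain z where z: "z \<in> closure \<Omega>"
        "\<And>y. y \<in> closure \<Omega> \<Longrightarrow> u (Suc (N + k)) y - \<phi> y \<le> u (Suc (N + k)) z - \<phi> z"
        using attains[of "Suc (N + k)"] by blast
      have "u (Suc (N + k)) z - \<phi> z \<le> B - real (Suc k) * (a * e)"
        using gap[OF _ z, simplified] Suc z(1) by (fastforce simp: algebra_simps)
      then show ?case using z(2) by (auto intro: order_trans)
    qed
    obtain k where "real k * (a * e) > B - (L - \<phi> w0)"
      using ex_less_of_nat_mult[of "a * e" "B - (L - \<phi> w0)"] a e by auto
    moreover have "L - \<phi> w0 \<le> B - real k * (a * e)"
      using drop[of k] L[OF w0, of "N + k"] w0 closure_subset[of \<Omega>] by fastforce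
    ultimately show False by linarith
  qed
qed

section \<open>The envelope\<close>

lemma h_envelope_ge:
  assumes "p \<in> \<Omega>" "\<And>q. q \<in> \<Omega> \<Longrightarrow> g q \<le> f q" "h_quasiconvex_on \<Omega> g"
  shows "g p \<le> h_envelope \<Omega> f p"
  unfolding h_envelope_def using assms by (intro cSup_upper) (auto intro!: bdd_aboveI[of _ "f p"])

lemma h_envelope_le:
  assumes "p \<in> \<Omega>" "\<And>q. q \<in> \<Omega> \<Longrightarrow> c \<le> f q"
    and "\<And>g. (\<And>q. q \<in> \<Omega> \<Longrightarrow> g q \<le> f q) \<Longrightarrow> h_quasiconvex_on \<Omega> g \<Longrightarrow> g p \<le> b"
  shows "h_envelope \<Omega> f p \<le> b"
proof -
  \<comment> \<open>The constant \<open>c\<close> is a competitor, so the supremum is over a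
    nonempty set.\<close>
  have "h_quasiconvex_on \<Omega> (\<lambda>_. c)" by (simp add: h_quasiconvex_on_def)
  then have "c \<in> {g p |g. (\<forall>q\<in>\<Omega>. g q \<le> f q) \<and> h_quasiconvex_on \<Omega> g}"
    using assms(2) by (intro CollectI exI[of _ "\<lambda>_. c"]) simp
  then have "{g p |g. (\<forall>q\<in>\<Omega>. g q \<le> f q) \<and> h_quasiconvex_on \<Omega> g} \<noteq> {}"
    by (metis empty_iff)
  then show ?thesis
    unfolding h_envelope_def using assms(3) by (intro cSup_least) auto
qed

lemma h_quasiconvex_on_h_envelope:
  assumes "h_convex \<Omega>" "\<And>q. q \<in> \<Omega> \<Longrightarrow> c \<le> f q"
  shows "h_quasiconvex_on \<Omega> (h_envelope \<Omega> f)"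
  unfolding h_quasiconvex_on_iff
proof (intro allI impI)
  fix p v and t :: real
  assume p: "p \<in> \<Omega>" "p \<odot> hvec v \<in> \<Omega>" and t: "0 \<le> t" "t \<le> 1"
  show "h_envelope \<Omega> f (p \<odot> hvec (t *\<^sub>R v)) \<le> max (h_envelope \<Omega> f p) (h_envelope \<Omega> f (p \<odot> hvec v))"
  proof (rule h_envelope_le[OF h_convex_mult_hvec[OF assms(1) p t] assms(2)])
    fix g assume g: "\<And>q. q \<in> \<Omega> \<Longrightarrow> g q \<le> f q" "h_quasiconvex_on \<Omega> g"
    then have "g (p \<odot> hvec (t *\<^sub>R v)) \<le> max (g p) (g (p \<odot> hvec v))"
      using p t unfolding h_quasiconvex_on_iff by blast
    also have "\<dots> \<le> max (h_envelope \<Omega> f p) (h_envelope \<Omega> f (p \<odot> hvec v))"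
      using h_envelope_ge[OF _ g] p by (intro max.mono) auto
    finally show "g (p \<odot> hvec (t *\<^sub>R v)) \<le> \<dots>" .
  qed
qed

text \<open>If one end lies outside \<open>\<Omega>\<close>, the right-hand side is already the
  global upper bound \<open>K\<close>; otherwise h-convexity keeps the segment inside.\<close>

lemma h_quasiconvex_on_extend:
  assumes "h_convex \<Omega>" "h_quasiconvex_on \<Omega> g" "\<And>q. q \<in> \<Omega> \<Longrightarrow> g q \<le> K"
  shows "h_quasiconvex_on UNIV (\<lambda>p. if p \<in> \<Omega> then g p else K)"
  unfolding h_quasiconvex_on_iff
proof (intro allI impI)
  fix p v and t :: real
  assume t: "0 \<le> t" "t \<le> 1"
  show "(if p \<odot> hvec (t *\<^sub>R v) \<in> \<Omega> then g (p \<odot> hvec (t *\<^sub>R v)) else K)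
      \<le> max (if p \<in> \<Omega> then g p else K) (if p \<odot> hvec v \<in> \<Omega> then g (p \<odot> hvec v) else K)"
  proof (cases "p \<in> \<Omega> \<and> p \<odot> hvec v \<in> \<Omega>")
    case True
    then have "p \<odot> hvec (t *\<^sub>R v) \<in> \<Omega>" using h_convex_mult_hvec assms(1) t by blast
    moreover have "g (p \<odot> hvec (t *\<^sub>R v)) \<le> max (g p) (g (p \<odot> hvec v))"
      using assms(2) True t unfolding h_quasiconvex_on_iff by blast
    ultimately show ?thesis using True by simp
  next
    case False
    then show ?thesis using assms(3) by (auto simp: le_max_iff_disj)
  qed
qed

text \<open>The extension by \<open>K\<close> is continuous because \<open>f = K\<close> on the
  frontier. Compactness gives a uniform modulus for base points in the closure; elsewhere the
  extension equals its maximum \<open>K\<close>, so the one-sided bound is immediate.\<close>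

lemma uniform_left_translation:
  assumes "open \<Omega>" "bounded \<Omega>" and f: "continuous_on (closure \<Omega>) f"
    and "\<And>p. p \<in> frontier \<Omega> \<Longrightarrow> f p = K" "\<And>p. p \<in> closure \<Omega> \<Longrightarrow> f p \<le> K"
    and "0 < (e::real)"
  shows "\<exists>d>0. \<forall>a p. norm a < d \<longrightarrow>
    (if a \<odot> p \<in> \<Omega> then f (a \<odot> p) else K) \<le> (if p \<in> \<Omega> then f p else K) + e"
proof -
  define F where "F p = (if p \<in> closure \<Omega> then f p else K)" for p
  have F_eq: "(if p \<in> \<Omega> then f p else K) = F p" for p
    using assms(1,4) closure_subset[of \<Omega>] by (auto simp: F_def frontier_def interior_open)
  have "continuous_on (closure \<Omega> \<union> - \<Omega>) F"
    unfolding F_def using f assms(1,4)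
    by (intro continuous_on_If) (auto simp: frontier_def interior_open)
  moreover have "closure \<Omega> \<union> - \<Omega> = UNIV" using closure_subset[of \<Omega>] by blast
  ultimately have F: "continuous_on UNIV F" by simp
  have FK: "F p \<le> K" for p using assms(5) by (simp add: F_def)
  have "continuous_on (cball 0 1 \<times> closure \<Omega>) (\<lambda>x. F (fst x \<odot> snd x))"
    by (intro continuous_on_compose2[OF F] continuous_intros) auto
  moreover have "compact (cball (0::heis) 1 \<times> closure \<Omega>)"
    using \<open>bounded \<Omega>\<close> by (intro compact_Times) (auto simp: compact_closure)
  ultimately have "uniformly_continuous_on (cball 0 1 \<times> closure \<Omega>) (\<lambda>x. F (fst x \<odot> snd x))"
    by (rule compact_uniformly_continuous)
  then obtain d where d: "d > 0"
    "\<And>x y. x \<in> cball 0 1 \<times> closure \<Omega> \<Longrightarrow> y \<in> cball 0 1 \<times> closure \<Omega> \<Longrightarrow> dist y x < d \<Longrightarrow>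
      dist (F (fst y \<odot> snd y)) (F (fst x \<odot> snd x)) < e"
    using \<open>0 < e\<close> unfolding uniformly_continuous_on_def by blast
  have "F (a \<odot> p) \<le> F p + e" if a: "norm a < min d 1" for a p
  proof (cases "p \<in> closure \<Omega>")
    case True
    then have "dist (F (a \<odot> p)) (F (0 \<odot> p)) < e"
      using a d(2)[of "(0, p)" "(a, p)"] by (simp add: dist_Pair_Pair)
    then show ?thesis by (simp add: dist_real_def)
  next
    case False
    then show ?thesis using FK[of "a \<odot> p"] \<open>0 < e\<close> by (simp add: F_def)
  qed
  then show ?thesis unfolding F_eq using d(1) by (intro exI[of _ "min d 1"]) auto
qed

text \<open>A one-sided bound suffices because it holds at every base point: the translations from
  \<open>p\<close> to \<open>q\<close> and back are inverse elements, which have equal norm.\<close>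

lemma continuous_on_left_uniform:
  fixes g :: "heis \<Rightarrow> real"
  assumes "\<And>e. e > 0 \<Longrightarrow> \<exists>d>0. \<forall>a p. norm a < d \<longrightarrow> g (a \<odot> p) \<le> g p + e"
  shows "continuous_on UNIV g"
  unfolding continuous_on_eq_continuous_at[OF open_UNIV] isCont_def
proof (intro ballI tendstoI)
  fix p and e :: real assume "0 < e"
  obtain d where d: "d > 0" "\<And>a p. norm a < d \<Longrightarrow> g (a \<odot> p) \<le> g p + e / 2"
    using assms[of "e / 2"] \<open>0 < e\<close> by auto
  have "continuous_on UNIV (\<lambda>q. q \<odot> heis_inv p)" by (intro continuous_intros)
  then have "(\<lambda>q. q \<odot> heis_inv p) \<midarrow>p\<rightarrow> p \<odot> heis_inv p"
    unfolding continuous_on_eq_continuous_at[OF open_UNIV] isCont_def by blast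
  then have "\<forall>\<^sub>F q in at p. norm (q \<odot> heis_inv p) < d"
    using tendstoD[of _ _ _ d] d(1) by fastforce
  then show "\<forall>\<^sub>F q in at p. dist (g q) (g p) < e"
  proof eventually_elim
    case (elim q)
    have "heis_inv (q \<odot> heis_inv p) = p \<odot> heis_inv q"
      by (cases p; cases q) (simp add: field_simps)
    then have "norm (p \<odot> heis_inv q) < d" using elim by (metis heis_inv_eq norm_minus_cancel)
    then have "g p \<le> g q + e / 2" using d(2)[of "p \<odot> heis_inv q" q] by (simp add: heis_mult_assoc)
    moreover have "g q \<le> g p + e / 2" using d(2)[OF elim, of p] by (simp add: heis_mult_assoc)
    ultimately show ?case using \<open>0 < e\<close> by (simp add: dist_real_def abs_less_iff)
  qed
qed

lemma Dini_decreasing: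
  fixes u :: "nat \<Rightarrow> 'a::metric_space \<Rightarrow> real"
  assumes S: "compact S" and u: "\<And>n. continuous_on S (u n)" and g: "continuous_on S g"
    and dec: "\<And>n x. x \<in> S \<Longrightarrow> u (Suc n) x \<le> u n x"
    and lim: "\<And>x. x \<in> S \<Longrightarrow> (\<lambda>n. u n x) \<longlonglongrightarrow> g x"
  shows "uniform_limit S u g sequentially"
  unfolding uniform_limit_iff
proof (intro allI impI)
  fix e :: real assume e: "e > 0"
  have mono: "u n x \<le> u m x" if "m \<le> n" "x \<in> S" for m n x
    using that(1) by (induction rule: dec_induct) (auto intro: order_trans[OF dec[OF that(2)]])
  have ge: "g x \<le> u n x" if "x \<in> S" for n x
    using lim[OF that] mono that
    by (intro LIMSEQ_le_const2[OF lim[OF that]] exI[of _ n]) auto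
  show "\<forall>\<^sub>F n in sequentially. \<forall>x\<in>S. dist (u n x) (g x) < e"
  proof (rule ccontr)
    assume "\<not> ?thesis"
    have "\<exists>x\<in>S. e \<le> u n x - g x" for n
    proof (rule ccontr)
      assume "\<not> ?thesis"
      then have "\<forall>m\<ge>n. \<forall>x\<in>S. dist (u m x) (g x) < e"
        using mono ge by (fastforce simp: dist_real_def)
      with \<open>\<not> (\<forall>\<^sub>F n in sequentially. _ n)\<close> show False by (auto simp: eventually_sequentially)
    qed
    then obtain x where x: "\<And>n. x n \<in> S" "\<And>n. e \<le> u n (x n) - g (x n)" by metis
    then obtain y r where y: "y \<in> S" "strict_mono r" "(x \<circ> r) \<longlonglongrightarrow> y"
      using S unfolding compact_def by metis
    \<comment> \<open>With \<open>m\<close> fixed, monotonicity replaces the index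
      \<open>r k\<close> by \<open>m\<close> once \<open>k \<ge> m\<close>, and continuity passes to
      the limit point. Letting \<open>m\<close> grow afterwards gives the contradiction.\<close>
    have "e \<le> u m y - g y" for m
    proof -
      have "(x \<circ> r) k \<in> S" for k using x(1) by simp
      then have "(\<lambda>k. u m ((x \<circ> r) k) - g ((x \<circ> r) k)) \<longlonglongrightarrow> u m y - g y"
        by (intro tendsto_diff continuous_on_tendsto_compose[OF u y(3,1)]
            continuous_on_tendsto_compose[OF g y(3,1)]) simp_all
      moreover have "e \<le> u m ((x \<circ> r) k) - g ((x \<circ> r) k)" if "k \<ge> m" for k
        using mono[of m "r k" "x (r k)"] x(1)[of "r k"] x(2)[of "r k"] seq_suble[OF y(2), of k] that by simp
      ultimately show ?thesis by (intro LIMSEQ_le_const) auto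
    qed
    then have "e \<le> g y - g y"
      using lim[OF y(1)] by (intro LIMSEQ_le_const[OF tendsto_diff[OF _ tendsto_const]]) auto
    with e show False by simp
  qed
qed

section \<open>Convergence of the iteration to the envelope\<close>

theorem theorem1p1:
  fixes \<Omega> :: "heis set" and f :: "heis \<Rightarrow> real" and K :: real
    and u :: "nat \<Rightarrow> heis \<Rightarrow> real"
  assumes "open \<Omega>" and "connected \<Omega>" and "bounded \<Omega>" and "h_convex \<Omega>"
    and "continuous_on (closure \<Omega>) f"
    and "\<And>p. p \<in> frontier \<Omega> \<Longrightarrow> f p = K"
    and "\<And>p. p \<in> closure \<Omega> \<Longrightarrow> f p \<le> K"
    and "\<And>p. p \<in> closure \<Omega> \<Longrightarrow> u 0 p = f p"
    and "\<And>n. continuous_on (closure \<Omega>) (u (Suc n))"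
    and "\<And>n. hj_viscosity_solution \<Omega> (u n) (u (Suc n))"
    and "\<And>n p. p \<in> frontier \<Omega> \<Longrightarrow> u (Suc n) p = K"
    and "\<And>n p. p \<in> closure \<Omega> \<Longrightarrow> u (Suc n) p \<le> K"
  shows "uniform_limit (closure \<Omega>) u (h_envelope_closure \<Omega> f) sequentially"
proof -
  have cpt: "compact (closure \<Omega>)" using assms(3) by (simp add: compact_closure)
  have sub\<Omega>: "p \<in> closure \<Omega>" if "p \<in> \<Omega>" for p using that closure_subset by blast
  have clos: "p \<in> \<Omega> \<or> p \<in> frontier \<Omega>" if "p \<in> closure \<Omega>" for p
    using that assms(1) by (auto simp: frontier_def interior_open)
  have disj: "p \<notin> \<Omega>" if "p \<in> frontier \<Omega>" for p
    using that assms(1) by (auto simp: frontier_def interior_open)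
  obtain c where c: "\<And>q. q \<in> \<Omega> \<Longrightarrow> c \<le> f q"
    using compact_continuous_image[OF assms(5) cpt] compact_imp_bounded bounded_imp_bdd_below sub\<Omega>
    by (metis bdd_below.E image_eqI)
  have u: "continuous_on (closure \<Omega>) (u n)" for n
    using assms(5,8,9) by (cases n) (auto cong: continuous_on_cong)
  have uK: "u n p \<le> K" if "p \<in> closure \<Omega>" for n p using that assms(7,8,12) by (cases n) auto
  have uK': "u n p = K" if "p \<in> frontier \<Omega>" for n p
    using that assms(6,8,11) by (cases n) (auto simp: frontier_def)
  have sub: "hj_subsolution \<Omega> (u n) (u (Suc n))" and super: "hj_supersolution \<Omega> (u n) (u (Suc n))" for n
    using assms(10) by (auto simp: hj_viscosity_solution_def)
  have dec: "u (Suc n) p \<le> u n p" if p: "p \<in> closure \<Omega>" for n p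
    using clos[OF p]
  proof
    assume p\<Omega>: "p \<in> \<Omega>"
    show ?thesis
    proof (rule hj_subsolution_le[OF assms(1) sub _ _ _ p\<Omega>])
      show "continuous_on \<Omega> (u n)" "continuous_on \<Omega> (u (Suc n))"
        using u closure_subset by (rule continuous_on_subset)+
      show "u (Suc n) q \<le> K" if "q \<in> \<Omega>" for q using that by (intro uK sub\<Omega>)
    qed
  qed (simp add: uK')
  \<comment> \<open>The envelope made global by the value \<open>K\<close>, so that its left
    translates are defined everywhere.\<close>
  define G where "G p = (if p \<in> \<Omega> then h_envelope \<Omega> f p else K)" for p
  have Gf: "G p \<le> f p" if "p \<in> \<Omega>" for p
    using h_envelope_le[of p \<Omega> c f "f p"] that c by (auto simp: G_def)
  have GK: "G p \<le> K" for p
    using Gf[of p] assms(7)[of p] sub\<Omega>[of p] by (cases "p \<in> \<Omega>") (auto simp: G_def)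
  have "h_quasiconvex_on UNIV (\<lambda>p. if p \<in> \<Omega> then h_envelope \<Omega> f p else K)"
  proof (rule h_quasiconvex_on_extend[OF assms(4) h_quasiconvex_on_h_envelope[OF assms(4)]])
    show "c \<le> f q" if "q \<in> \<Omega>" for q using c that .
    show "h_envelope \<Omega> f q \<le> K" if "q \<in> \<Omega>" for q using GK[of q] that by (simp add: G_def)
  qed
  then have Gqc: "h_quasiconvex_on UNIV G" unfolding G_def .
  \<comment> \<open>For small \<open>a\<close>, the translate of \<open>G\<close> by
    \<open>a\<close>, lowered by \<open>e\<close>, is h-quasiconvex and below \<open>f\<close>. It
    therefore competes in the envelope and lies below it.\<close>
  have left: "\<exists>d>0. \<forall>a p. norm a < d \<longrightarrow> G (a \<odot> p) \<le> G p + e" if e: "e > 0" for e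
  proof -
    define F where "F p = (if p \<in> \<Omega> then f p else K)" for p
    obtain d where d: "d > 0" "\<And>a p. norm a < d \<Longrightarrow> F (a \<odot> p) \<le> F p + e"
      using uniform_left_translation[OF assms(1,3,5,6,7) e] unfolding F_def by blast
    have "G (a \<odot> p) \<le> G p + e" if a: "norm a < d" for a p
    proof (cases "p \<in> \<Omega>")
      case True
      have "G (a \<odot> q) - e \<le> f q" if "q \<in> \<Omega>" for q
      proof -
        have "G (a \<odot> q) \<le> F (a \<odot> q)" using Gf by (simp add: F_def G_def)
        with d(2)[OF a, of q] that show ?thesis by (simp add: F_def)
      qed
      moreover have "h_quasiconvex_on \<Omega> (\<lambda>q. G (a \<odot> q) - e)"
        unfolding h_quasiconvex_on_iff heis_mult_assoc[symmetric]
      proof (intro allI impI)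
        fix q v and t :: real assume "0 \<le> t" "t \<le> 1"
        then have "G (a \<odot> q \<odot> hvec (t *\<^sub>R v)) \<le> max (G (a \<odot> q)) (G (a \<odot> q \<odot> hvec v))"
          using Gqc unfolding h_quasiconvex_on_iff by blast
        then show "G (a \<odot> q \<odot> hvec (t *\<^sub>R v)) - e \<le> max (G (a \<odot> q) - e) (G (a \<odot> q \<odot> hvec v) - e)"
          by linarith
      qed
      ultimately have "G (a \<odot> p) - e \<le> h_envelope \<Omega> f p"
        using h_envelope_ge[OF True, of "\<lambda>q. G (a \<odot> q) - e"] by blast
      then show ?thesis using True by (simp add: G_def)
    next
      case False
      then show ?thesis using GK[of "a \<odot> p"] e by (simp add: G_def)
    qed
    with d(1) show ?thesis by blast
  qed
  have Gc: "continuous_on UNIV G" using continuous_on_left_uniform left by blast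
  \<comment> \<open>Each step applies comparison with right-hand side \<open>u n\<close>, which
    dominates \<open>G\<close> by induction.\<close>
  have Gu: "G p \<le> u n p" if "p \<in> closure \<Omega>" for n p
    using that
  proof (induction n arbitrary: p)
    case 0
    then show ?case using clos[OF 0] Gf[of p] assms(8)[OF 0] uK'[of p 0] GK[of p] by auto
  next
    case (Suc n)
    show ?case
      using h_quasiconvex_le_supersolution[OF assms(3) Gqc Gc GK left u uK' assms(1) super, of n p]
        Suc sub\<Omega> by blast
  qed
  have conv: "(\<lambda>n. u n p) \<longlonglongrightarrow> (INF n. u n p)" and INF_le: "(INF n. u n p) \<le> u n p"
    if p: "p \<in> closure \<Omega>" for n p
  proof -
    have bdd: "bdd_below (range (\<lambda>n. u n p))" using Gu[OF p] by (auto intro!: bdd_belowI[of _ "G p"])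
    show "(\<lambda>n. u n p) \<longlonglongrightarrow> (INF n. u n p)"
      using dec[OF p] by (intro LIMSEQ_decseq_INF[OF bdd]) (simp add: decseq_Suc_iff)
    show "(INF n. u n p) \<le> u n p" using bdd by (intro cINF_lower) auto
  qed
  obtain b where b: "\<And>n q. q \<in> \<Omega> \<Longrightarrow> b \<le> u n q"
  proof -
    obtain b where "\<And>q. q \<in> closure \<Omega> \<Longrightarrow> b \<le> G q"
      using compact_continuous_image[OF continuous_on_subset[OF Gc] cpt] compact_imp_bounded
        bounded_imp_bdd_below by (metis bdd_below.E image_eqI subset_UNIV)
    then show thesis using that Gu sub\<Omega> by (meson order_trans)
  qed
  define U where "U p = (INF n. u n p)" for p
  have "h_quasiconvex_on \<Omega> U"
    unfolding h_quasiconvex_on_iff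
  proof (intro allI impI)
    fix p v and t :: real
    assume p: "p \<in> \<Omega>" "p \<odot> hvec v \<in> \<Omega>" and t: "0 \<le> t" "t \<le> 1"
    define w where "w = p \<odot> hvec (t *\<^sub>R v)"
    have w: "w \<in> \<Omega>" unfolding w_def using h_convex_mult_hvec assms(4) p t by blast
    show "U w \<le> max (U p) (U (p \<odot> hvec v))"
    proof (rule ccontr)
      assume "\<not> ?thesis"
      \<comment> \<open>The segment lemma is used with \<open>l' = U w\<close>: once both ends fall
        below \<open>l\<close>, some iterate at \<open>w\<close> falls below its own
        infimum.\<close>
      then obtain l where "max (U p) (U (p \<odot> hvec v)) < l" "l < U w"
        using dense not_le by blast
      then have l: "U p < l" "U (p \<odot> hvec v) < l" "l < U w" by simp_all
      have "\<forall>\<^sub>F n in sequentially. u n p < l" "\<forall>\<^sub>F n in sequentially. u n (p \<odot> hvec v) < l"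
        using order_tendstoD(2)[OF conv[OF sub\<Omega>[OF p(1)]]] order_tendstoD(2)[OF conv[OF sub\<Omega>[OF p(2)]]]
          l(1,2) unfolding U_def by blast+
      then have "\<forall>\<^sub>F n in sequentially. u n p < l \<and> u n (p \<odot> hvec v) < l" by (rule eventually_conj)
      then obtain N where "u N p < l" "u N (p \<odot> hvec v) < l"
        by (auto simp: eventually_sequentially)
      then obtain n where "u n w < U w"
        using hj_iteration_segment[where u = u, OF assms(1,3,4) u uK b dec sub p t _ _ l(3)]
        unfolding w_def by blast
      then show False using INF_le[OF sub\<Omega>[OF w], of n] by (simp add: U_def)
    qed
  qed
  moreover have "U q \<le> f q" if "q \<in> \<Omega>" for q
    using INF_le[OF sub\<Omega>[OF that], of 0] assms(8)[OF sub\<Omega>[OF that]] by (simp add: U_def)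
  \<comment> \<open>The limit \<open>U\<close> is itself a competitor in the envelope.\<close>
  ultimately have UG: "U p \<le> G p" if "p \<in> \<Omega>" for p
    using h_envelope_ge[OF that, of U f] that by (simp add: G_def)
  have UG': "U p = G p" if p: "p \<in> closure \<Omega>" for p
    using clos[OF p]
  proof
    assume "p \<in> \<Omega>"
    moreover have "G p \<le> U p" unfolding U_def by (intro cINF_greatest) (use Gu[OF p] in auto)
    ultimately show ?thesis using UG by (simp add: antisym)
  qed (use disj in \<open>auto simp: U_def G_def uK'\<close>)
  have "uniform_limit (closure \<Omega>) u G sequentially"
  \<comment> \<open>The continuous limit that Dini's theorem requires is \<open>G\<close>, whose
    continuity came from translations and not from the iteration.\<close>
  proof (rule Dini_decreasing[where u = u, OF cpt u _ dec])
    show "continuous_on (closure \<Omega>) G" using Gc by (rule continuous_on_subset) simp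
    show "(\<lambda>n. u n p) \<longlonglongrightarrow> G p" if "p \<in> closure \<Omega>" for p
      using conv[OF that] UG'[OF that] by (simp add: U_def)
  qed
  moreover have "G p = h_envelope_closure \<Omega> f p" if "p \<in> closure \<Omega>" for p
    using clos[OF that] disj[of p] assms(6)[of p] by (auto simp: G_def h_envelope_closure_def)
  ultimately show ?thesis by (simp cong: uniform_limit_cong')
qed

end
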